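(* For $n\in\mathbb{N}$ let $$G_n'=\inf\left\{P\left(|a\cdot\epsilon|>\|a\|\right): a=(a_1,\dots,a_n)\in\mathbb{R}^n,\ a_i\ne 0\ \text{for all } i=1,\dots,n\right\}.$$ Then $$G_1'=0,\quad G_2'=\frac12,\quad G_3'=G_5'=\frac14,\quad G_4'=\frac18,\quad G_6'=\frac{3}{16},\quad G_7'=\frac{7}{32}.$$
   Context: $\epsilon=(\epsilon_1,\dots,\epsilon_n)$, where $\epsilon_1,\dots,\epsilon_n$ are independent random variables with $P(\epsilon_i=1)=P(\epsilon_i=-1)=\frac12$. For $a=(a_1,\dots,a_n)\in\mathbb{R}^n$, $a\cdot\epsilon=a_1\epsilon_1+\cdots+a_n\epsilon_n$ and $\|a\|=(\sum_{i=1}^n a_i^2)^{1/2}$. *)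

theory Defs
  imports "HOL-Probability.Probability"
begin

locale rademacher_vars = prob_space M
  for M :: "'w measure" and n :: nat and eps :: "nat \<Rightarrow> 'w \<Rightarrow> real" +
  assumes indep: "indep_vars (\<lambda>_. borel) eps {1..n}"
    and prob_pos: "\<And>i. i \<in> {1..n} \<Longrightarrow> prob {w \<in> space M. eps i w = 1} = 1/2"
    and prob_neg: "\<And>i. i \<in> {1..n} \<Longrightarrow> prob {w \<in> space M. eps i w = -1} = 1/2"

(* Vectors in R^n are functions on the naturals of which only the values at 1, ..., n are used,
   so that the dimension can be an ordinary argument; the Euclidean norm is then L2_set. *)

definition lin_comb :: "nat \<Rightarrow> (nat \<Rightarrow> real) \<Rightarrow> (nat \<Rightarrow> 'w \<Rightarrow> real) \<Rightarrow> 'w \<Rightarrow> real" where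
  "lin_comb n a eps w = (\<Sum>i=1..n. a i * eps i w)"

definition G' :: "'w measure \<Rightarrow> nat \<Rightarrow> (nat \<Rightarrow> 'w \<Rightarrow> real) \<Rightarrow> real" where
  "G' M n eps = Inf {measure M {w \<in> space M. \<bar>lin_comb n a eps w\<bar> > L2_set a {1..n}} | a.
     \<forall>i\<in>{1..n}. a i \<noteq> 0}"

lemma rademacher_vars_exist:
  "rademacher_vars (measure_pmf (Pi_pmf {1..n} 0 (\<lambda>_. pmf_of_set {-1, 1 :: real}))) n (\<lambda>i w. w i)"
proof -
  let ?p = "Pi_pmf {1..n} 0 (\<lambda>_. pmf_of_set {-1, 1 :: real})"
  have *: "measure_pmf.prob ?p {w \<in> space (measure_pmf ?p). w i = c} = 1/2"
    if i: "i \<in> {1..n}" and c: "c \<in> {-1, 1}" for i c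
  proof -
    have "measure_pmf.prob ?p {w \<in> space (measure_pmf ?p). w i = c}
        = measure_pmf.prob (map_pmf (\<lambda>w. w i) ?p) {c}"
      by (simp add: vimage_def)
    also have "map_pmf (\<lambda>w. w i) ?p = pmf_of_set {-1, 1}"
      using i by (subst Pi_pmf_component) auto
    also have "measure_pmf.prob (pmf_of_set {-1, 1 :: real}) {c} = 1/2"
      using c by (auto simp: measure_pmf_single)
    finally show ?thesis .
  qed
  show ?thesis
  proof (unfold_locales)
    have "prob_space.indep_vars ?p (\<lambda>_. count_space UNIV) (\<lambda>i w. w i) {1..n}"
      by (rule indep_vars_Pi_pmf) simp
    then have "prob_space.indep_vars ?p (\<lambda>_. borel) (\<lambda>i. (\<lambda>x. x) \<circ> (\<lambda>w. w i)) {1..n}"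
      by (rule prob_space.indep_vars_compose[OF prob_space_measure_pmf]) simp
    then show "prob_space.indep_vars ?p (\<lambda>_. borel) (\<lambda>i w. w i) {1..n}"
      by (simp add: comp_def)
  qed (use * in auto)
qed

end

theory Submission
  imports Defs
begin

text \<open>
  The \<open>2 ^ n\<close> sign patterns are equally likely, so the probability that
  \<open>\<bar>a \<cdot> \<epsilon>\<bar>\<close> exceeds the norm \<open>N\<close> of
  \<open>a\<close> is a number of patterns divided by \<open>2 ^ n\<close>. Changing signs
  of coordinates and permuting them changes neither this number nor \<open>N\<close>, so
  \<open>a\<close> may be taken positive and decreasing. Patterns are then described by the
  list of coordinates that get the sign \<open>-1\<close>; a list wins if the signed sum
  exceeds \<open>N\<close>. Every winning list gives two patterns (itself and its negative),
  so the values to be proved say that at least 1, 1, 1, 4, 6, 14 lists win in dimensions 2,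
  3, 4, 5, 6, 7. In dimension 1 nothing wins, and in all dimensions an explicit vector
  attains the bound.

  Winning is inherited by lists with fewer flips or with flips at later, smaller coordinates
  (\<open>wins_mono\<close>). A count of winning lists therefore follows from a few
  alternatives of the form "one of these lists wins". For dimension 7 they are, writing 27
  for the list \<open>[2, 7]\<close> and so on: 27 or 36 or 45; 2 or 45 or 567; 2 or 36 or
  457; 17 or 56; 1 or 46 or 567; 1 or 37 or 567. The list 36 brings 13 winning lists with it
  and the second alternative one more; 27 brings 12 and the fourth and fifth alternatives
  two more; 45 brings 11, and then 457 brings three more, or 2 brings two more and the last
  alternative another one.

  The alternatives are proved by linear arithmetic. With the gaps \<open>d\<^sub>j =
  a\<^sub>j - a\<^sub>j\<^sub>+\<^sub>1\<close> (where \<open>a\<^sub>n\<^sub>+\<^sub>1 =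
  0\<close>), the vector \<open>a\<close> is the sum of \<open>d\<^sub>j\<close> times the
  indicator vector of the first \<open>j\<close> coordinates, and the triangle inequality
  gives \<open>N \<le> (\<Sum>j. sqrt j * d\<^sub>j)\<close>. A signed sum is
  \<open>\<Sum>j. p\<^sub>j * d\<^sub>j\<close>, where \<open>p\<^sub>j\<close> is the sum
  of the first \<open>j\<close> signs. If some weighted average of the
  \<open>p\<^sub>j\<close> over the lists of an alternative is at least \<open>sqrt
  j\<close> for all \<open>j\<close>, and strictly so for \<open>j = n\<close>, then the
  lists cannot all fail, because \<open>d\<^sub>n = a\<^sub>n > 0\<close>.

  The last three alternatives lack such weights. For them \<open>a\<close> is decomposed
  into staircases with possibly more than one step, the sum of the indicator vectors of the
  first \<open>j\<close> coordinates over \<open>j\<close> in a list \<open>J\<close>; then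
  it is the sum of the averaged \<open>p\<^sub>j\<close> over \<open>j\<close> in
  \<open>J\<close> that has to be compared with the norm of the staircase, and this norm is
  smaller than the sum of the corresponding \<open>sqrt j\<close>. The staircases needed are
  \<open>(2, 1, 1, 1, 1, 1, 0)\<close>, of norm 3, \<open>(2, 2, 2, 1, 1, 1, 1)\<close>, of
  norm 4, and \<open>(3, 2, 2, 1, 1, 1, 1)\<close>. The first two are no accident: without
  the final zero they are vectors that attain the infimum in dimensions 6 and 7.
\<close>

section \<open>Probabilities as numbers of sign patterns\<close>

definition signed_sum :: "nat \<Rightarrow> (nat \<Rightarrow> real) \<Rightarrow> nat set \<Rightarrow> real" where
  "signed_sum n a T = (\<Sum>i=1..n. if i \<in> T then - a i else a i)"

text \<open>
  The predicate is an argument because the recursion over the dimension shifts it by the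
  last coordinate.
\<close>

definition sign_count :: "nat \<Rightarrow> (nat \<Rightarrow> real) \<Rightarrow> (real \<Rightarrow> bool) \<Rightarrow> nat" where
  "sign_count n a P = card {T. T \<subseteq> {1..n} \<and> P (signed_sum n a T)}"

lemma sign_count_0: "sign_count 0 a P = of_bool (P 0)"
proof -
  have "{T::nat set. T \<subseteq> {1..0} \<and> P (signed_sum 0 a T)} = (if P 0 then {{}} else {})"
    by (auto simp: signed_sum_def)
  then show ?thesis by (simp add: sign_count_def)
qed

text \<open>
  Splitting by the sign of the last coordinate. Together with the previous equation this
  evaluates the count for a concrete vector by rewriting.
\<close>

lemma sign_count_Suc:
  "sign_count (Suc n) a P =
    sign_count n a (\<lambda>x. P (x + a (Suc n))) + sign_count n a (\<lambda>x. P (x - a (Suc n)))"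
proof -
  let ?A = "{T. T \<subseteq> {1..n} \<and> P (signed_sum n a T + a (Suc n))}"
  let ?B = "{T. T \<subseteq> {1..n} \<and> P (signed_sum n a T - a (Suc n))}"
  have keep: "signed_sum (Suc n) a T = signed_sum n a T + a (Suc n)" if "T \<subseteq> {1..n}" for T
    using that by (auto simp: signed_sum_def)
  have flip: "signed_sum (Suc n) a (insert (Suc n) T) = signed_sum n a T - a (Suc n)" for T
    by (auto simp: signed_sum_def intro!: sum.cong)
  have "{T. T \<subseteq> {1..Suc n} \<and> P (signed_sum (Suc n) a T)} = ?A \<union> insert (Suc n) ` ?B" (is "?L = _")
  proof (intro equalityI subsetI)
    fix T assume T: "T \<in> ?L"
    show "T \<in> ?A \<union> insert (Suc n) ` ?B"
    proof (cases "Suc n \<in> T")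
      case True
      then have "T = insert (Suc n) (T - {Suc n})" by auto
      moreover have "T - {Suc n} \<in> ?B"
        using T flip[of "T - {Suc n}"] True by (auto simp: insert_absorb le_Suc_eq)
      ultimately show ?thesis by blast
    next
      case False
      then have "T \<subseteq> {1..n}" using T by (auto simp: le_Suc_eq)
      then show ?thesis using T keep by auto
    qed
  qed (use keep flip in auto)
  moreover have "inj_on (insert (Suc n)) ?B"
    by (rule inj_onI, subst (asm) insert_ident) auto
  moreover have "?A \<inter> insert (Suc n) ` ?B = {}" by auto
  moreover have "finite ?A" "finite ?B" by auto
  ultimately show ?thesis
    unfolding sign_count_def by (simp add: card_Un_disjoint card_image)
qed

lemmas sign_count_eval = sign_count_Suc sign_count_0 numeral_eq_Suc power2_eq_square

lemma (in rademacher_vars) prob_sign_pattern: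
  assumes "n \<ge> 1"
  shows "{w \<in> space M. \<forall>i\<in>{1..n}. eps i w = (if i \<in> T then -1 else 1)} \<in> events" (is "?E \<in> _")
    and "prob {w \<in> space M. \<forall>i\<in>{1..n}. eps i w = (if i \<in> T then -1 else 1)} = 1 / 2 ^ n"
proof -
  let ?s = "\<lambda>i. if i \<in> T then -1 else 1 :: real"
  have rv: "random_variable borel (eps i)" if "i \<in> {1..n}" for i
    using indep that unfolding indep_vars_def by blast
  have E: "?E = (\<Inter>i\<in>{1..n}. eps i -` {?s i} \<inter> space M)"
    using assms by auto
  show "?E \<in> events"
    unfolding E using assms rv by (intro sets.finite_INT) (auto intro!: measurable_sets[of _ M borel])
  have "prob ?E = (\<Prod>i\<in>{1..n}. prob (eps i -` {?s i} \<inter> space M))"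
    unfolding E using assms by (intro indep_varsD[OF indep]) auto
  also have "\<dots> = (\<Prod>i\<in>{1..n}. 1/2)"
  proof (rule prod.cong)
    fix i assume "i \<in> {1..n}"
    have "eps i -` {?s i} \<inter> space M = {w \<in> space M. eps i w = ?s i}" by auto
    then show "prob (eps i -` {?s i} \<inter> space M) = 1/2"
      using prob_pos[OF \<open>i \<in> {1..n}\<close>] prob_neg[OF \<open>i \<in> {1..n}\<close>] by simp
  qed simp
  finally show "prob ?E = 1 / 2 ^ n"
    by (simp add: power_one_over)
qed

text \<open>
  The \<open>2 ^ n\<close> events "the pattern is \<open>T\<close>" are disjoint with total
  probability 1. They need not cover the sample space, since the variables may take other
  values on a null set, so the event is compared with a union of them almost everywhere.
\<close>

lemma (in rademacher_vars) prob_lin_comb: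
  assumes n: "n \<ge> 1" and B: "B \<in> sets borel"
  shows "prob {w \<in> space M. lin_comb n a eps w \<in> B} = sign_count n a (\<lambda>x. x \<in> B) / 2 ^ n"
proof -
  define E where "E T = {w \<in> space M. \<forall>i\<in>{1..n}. eps i w = (if i \<in> T then -1 else 1)}" for T
  let ?A = "{w \<in> space M. lin_comb n a eps w \<in> B}"
  let ?G = "{T. T \<subseteq> {1..n} \<and> signed_sum n a T \<in> B}"
  have E: "E T \<in> events" "prob (E T) = 1 / 2 ^ n" for T
    unfolding E_def by (rule prob_sign_pattern[OF n])+
  have rv: "random_variable borel (eps i)" if "i \<in> {1..n}" for i
    using indep that unfolding indep_vars_def by blast
  have "random_variable borel (\<lambda>w. lin_comb n a eps w)"
    unfolding lin_comb_def using rv by (intro borel_measurable_sum borel_measurable_times) auto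
  then have A: "?A \<in> events"
    using B by (simp add: measurable_sets_Collect)
  have "T = U" if "T \<subseteq> {1..n}" "U \<subseteq> {1..n}" "w \<in> E T" "w \<in> E U" for T U w
  proof -
    have "i \<in> T \<longleftrightarrow> i \<in> U" if "i \<in> {1..n}" for i
      using \<open>w \<in> E T\<close> \<open>w \<in> E U\<close> that by (auto simp: E_def split: if_splits)
    then show "T = U" using that by blast
  qed
  then have disj: "disjoint_family_on E (Pow {1..n})"
    unfolding disjoint_family_on_def by blast
  have union: "prob (\<Union>T\<in>F. E T) = card F / 2 ^ n" if F: "F \<subseteq> Pow {1..n}" for F
  proof -
    have "finite F" using F by (rule finite_subset) simp
    then have "prob (\<Union>T\<in>F. E T) = (\<Sum>T\<in>F. prob (E T))"
      using E(1) disjoint_family_on_mono[OF F disj]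
      by (intro finite_measure_finite_Union) auto
    then show ?thesis by (simp add: E(2))
  qed
  have all_E: "(\<Union>T\<in>F. E T) \<in> events" if "F \<subseteq> Pow {1..n}" for F
    using that E(1) by (intro sets.finite_UN) (auto intro: finite_subset)
  have "prob (\<Union>T\<in>Pow {1..n}. E T) = 1"
    using union[of "Pow {1..n}"] by (simp add: card_Pow)
  then have AE: "AE w in M. w \<in> (\<Union>T\<in>Pow {1..n}. E T)"
    using all_E[of "Pow {1..n}"] prob_eq_1 by blast
  have sum: "lin_comb n a eps w = signed_sum n a T" if "w \<in> E T" for w T
    using that unfolding lin_comb_def signed_sum_def E_def by (intro sum.cong) auto
  have iff: "w \<in> ?A \<longleftrightarrow> w \<in> (\<Union>T\<in>?G. E T)" if w: "w \<in> (\<Union>T\<in>Pow {1..n}. E T)" for w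
  proof
    assume "w \<in> ?A"
    then show "w \<in> (\<Union>T\<in>?G. E T)" using w sum by auto
  next
    assume "w \<in> (\<Union>T\<in>?G. E T)"
    then obtain T where T: "w \<in> E T" "signed_sum n a T \<in> B" by blast
    then have "w \<in> space M" by (simp add: E_def)
    then show "w \<in> ?A" using sum[OF T(1)] T(2) by simp
  qed
  have "AE w in M. w \<in> ?A \<longleftrightarrow> w \<in> (\<Union>T\<in>?G. E T)"
    by (rule eventually_mono[OF AE iff])
  then have "prob ?A = prob (\<Union>T\<in>?G. E T)"
    by (intro finite_measure_eq_AE A all_E) auto
  also have "\<dots> = card ?G / 2 ^ n"
    by (rule union) auto
  finally show ?thesis by (simp add: sign_count_def)
qed

section \<open>Reduction to positive decreasing vectors\<close>

lemma signed_sum_complement: "signed_sum n a ({1..n} - T) = - signed_sum n a T"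
  unfolding signed_sum_def sum_negf[symmetric] by (intro sum.cong) auto

lemma sign_count_cong_bij:
  assumes h: "bij_betw h (Pow {1..n}) (Pow {1..n})"
    and sum: "\<And>T. T \<subseteq> {1..n} \<Longrightarrow> signed_sum n a (h T) = signed_sum n b T"
  shows "sign_count n b P = sign_count n a P"
proof -
  let ?A = "{T. T \<subseteq> {1..n} \<and> P (signed_sum n a T)}"
  let ?B = "{T. T \<subseteq> {1..n} \<and> P (signed_sum n b T)}"
  have maps: "h T \<subseteq> {1..n}" if "T \<subseteq> {1..n}" for T
    using bij_betw_apply[OF h, of T] that by simp
  have "inj_on h ?B"
    using h by (auto simp: bij_betw_def intro: inj_on_subset)
  moreover have "h ` ?B = ?A"
  proof (intro equalityI subsetI)
    fix U assume "U \<in> h ` ?B"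
    then obtain T where "T \<subseteq> {1..n}" "P (signed_sum n b T)" "U = h T" by blast
    then show "U \<in> ?A" using maps sum by simp
  next
    fix U assume U: "U \<in> ?A"
    then have "U \<in> h ` Pow {1..n}" using bij_betw_imp_surj_on[OF h] by auto
    then obtain T where "T \<subseteq> {1..n}" "U = h T" by auto
    then show "U \<in> h ` ?B" using U sum by simp
  qed
  ultimately show ?thesis
    unfolding sign_count_def using card_image by fastforce
qed

lemma sign_count_permute:
  assumes p: "bij_betw p {1..n} {1..n}"
  shows "sign_count n (\<lambda>i. a (p i)) P = sign_count n a P"
proof (rule sign_count_cong_bij)
  show "bij_betw ((`) p) (Pow {1..n}) (Pow {1..n})"
    using p by (rule bij_betw_Pow)
  fix T assume "T \<subseteq> {1..n}"
  then have "i \<in> T \<longleftrightarrow> p i \<in> p ` T" if "i \<in> {1..n}" for i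
    using that p by (metis bij_betw_def inj_on_image_mem_iff)
  then have "signed_sum n (\<lambda>i. a (p i)) T = (\<Sum>i=1..n. if p i \<in> p ` T then - a (p i) else a (p i))"
    unfolding signed_sum_def by (intro sum.cong) auto
  also have "\<dots> = signed_sum n a (p ` T)"
    unfolding signed_sum_def by (rule sum.reindex_bij_betw[OF p])
  finally show "signed_sum n a (p ` T) = signed_sum n (\<lambda>i. a (p i)) T" ..
qed

lemma sign_count_abs: "sign_count n (\<lambda>i. \<bar>a i\<bar>) P = sign_count n a P"
proof (rule sign_count_cong_bij)
  let ?h = "\<lambda>T. {i \<in> {1..n}. (i \<in> T) \<noteq> (a i < 0)}"
  show "bij_betw ?h (Pow {1..n}) (Pow {1..n})"
    by (rule bij_betw_byWitness[where f' = ?h]) auto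
  show "signed_sum n a (?h T) = signed_sum n (\<lambda>i. \<bar>a i\<bar>) T" for T
    unfolding signed_sum_def by (intro sum.cong) auto
qed

lemma ex_decreasing_arrangement:
  fixes f :: "nat \<Rightarrow> real"
  obtains p where "bij_betw p {1..n} {1..n}"
    and "\<And>i j. \<lbrakk>1 \<le> i; i \<le> j; j \<le> n\<rbrakk> \<Longrightarrow> f (p j) \<le> f (p i)"
proof
  let ?xs = "sort_key (\<lambda>i. - f i) [1..<Suc n]"
  let ?p = "\<lambda>i. ?xs ! (i - 1)"
  have "bij_betw (\<lambda>i. i - 1) {1..n} {..<n}"
    by (rule bij_betw_byWitness[where f' = Suc]) auto
  moreover have "bij_betw ((!) ?xs) {..<n} (set ?xs)"
    by (intro bij_betw_nth) auto
  ultimately have "bij_betw ((!) ?xs \<circ> (\<lambda>i. i - 1)) {1..n} (set ?xs)"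
    by (rule bij_betw_trans)
  then show "bij_betw ?p {1..n} {1..n}"
    by (simp add: comp_def atLeastLessThanSuc_atLeastAtMost del: upt_Suc)
  fix i j assume ij: "1 \<le> i" "i \<le> j" "j \<le> n"
  have "sorted (map (\<lambda>i. - f i) ?xs)" by simp
  from sorted_nth_mono[OF this, of "i - 1" "j - 1"] ij
  show "f (?p j) \<le> f (?p i)" by (simp del: upt_Suc)
qed

locale decreasing_vector =
  fixes n :: nat and a :: "nat \<Rightarrow> real"
  assumes pos: "i \<in> {1..n} \<Longrightarrow> 0 < a i"
    and decreasing: "\<lbrakk>1 \<le> i; i \<le> j; j \<le> n\<rbrakk> \<Longrightarrow> a j \<le> a i"

lemma norm_less_iff: "L2_set a {1..n} < \<bar>x\<bar> \<longleftrightarrow> (\<Sum>i=1..n. (a i)\<^sup>2) < x\<^sup>2"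
  unfolding L2_set_def real_sqrt_abs[symmetric] by (rule real_sqrt_less_iff)

text \<open>
  The form in which the values of the infimum are established: a lower bound on the count
  for all positive decreasing vectors, attained by one vector with nonzero coordinates. For
  the latter the comparison is squared, so that it can be evaluated without square roots.
\<close>

lemma G'_eqI:
  assumes rad: "rademacher_vars M n eps" and n: "n \<ge> 1"
    and lower: "\<And>b. decreasing_vector n b \<Longrightarrow>
      c \<le> sign_count n b (\<lambda>x. L2_set b {1..n} < \<bar>x\<bar>)"
    and witness: "\<forall>i\<in>{1..n}. b i \<noteq> 0" "sign_count n b (\<lambda>x. (\<Sum>i=1..n. (b i)\<^sup>2) < x\<^sup>2) = c"
  shows "G' M n eps = c / 2 ^ n"
proof -
  let ?P = "\<lambda>a. measure M {w \<in> space M. L2_set a {1..n} < \<bar>lin_comb n a eps w\<bar>}"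
  let ?X = "{?P a | a. \<forall>i\<in>{1..n}. a i \<noteq> 0}"
  have prob: "measure M {w \<in> space M. r < \<bar>lin_comb n a eps w\<bar>} = sign_count n a (\<lambda>x. r < \<bar>x\<bar>) / 2 ^ n"
    for a and r :: real
    using rademacher_vars.prob_lin_comb[OF rad n, of "{x. r < \<bar>x\<bar>}" a] by simp
  have "c / 2 ^ n \<le> ?P a" if a: "\<forall>i\<in>{1..n}. a i \<noteq> 0" for a
  proof -
    obtain p where p: "bij_betw p {1..n} {1..n}"
      and dec: "\<And>i j. \<lbrakk>1 \<le> i; i \<le> j; j \<le> n\<rbrakk> \<Longrightarrow> \<bar>a (p j)\<bar> \<le> \<bar>a (p i)\<bar>"
      using ex_decreasing_arrangement[of n "\<lambda>i. \<bar>a i\<bar>"] by blast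
    define b where "b i = \<bar>a (p i)\<bar>" for i
    have "p i \<in> {1..n}" if "i \<in> {1..n}" for i
      using p that by (auto simp: bij_betw_def)
    then have "decreasing_vector n b"
      using a dec by unfold_locales (auto simp: b_def)
    moreover have "L2_set b {1..n} = L2_set a {1..n}"
      unfolding L2_set_def b_def using sum.reindex_bij_betw[OF p, of "\<lambda>i. (a i)\<^sup>2"] by simp
    moreover have "sign_count n b Q = sign_count n a Q" for Q
      unfolding b_def by (subst sign_count_permute[OF p, of "\<lambda>i. \<bar>a i\<bar>"]) (rule sign_count_abs)
    ultimately have "c \<le> sign_count n a (\<lambda>x. L2_set a {1..n} < \<bar>x\<bar>)"
      using lower[of b] by simp
    then show ?thesis
      by (simp add: prob divide_right_mono)
  qed
  moreover have "?P b = c / 2 ^ n"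
    using witness(2) unfolding prob by (simp only: norm_less_iff)
  ultimately have "Inf ?X = c / 2 ^ n"
  proof (intro cInf_eq_minimum)
    assume eq: "?P b = c / 2 ^ n"
    show "c / 2 ^ n \<in> ?X"
      by (rule CollectI, rule exI[of _ b]) (use eq witness(1) in simp)
  qed blast
  then show ?thesis by (simp add: G'_def)
qed

section \<open>Winning lists of sign changes\<close>

definition wins :: "nat \<Rightarrow> (nat \<Rightarrow> real) \<Rightarrow> nat list \<Rightarrow> bool" where
  "wins n a xs \<longleftrightarrow> L2_set a {1..n} < (\<Sum>i=1..n. a i) - 2 * (\<Sum>i\<leftarrow>xs. a i)"

text \<open>
  For increasing lists of indices of a decreasing vector this compares the sums over the two
  lists: \<open>xs\<close> arises from \<open>ys\<close> by deleting entries and replacing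
  others by larger indices, that is, by smaller coordinates.
\<close>

definition dominated :: "nat list \<Rightarrow> nat list \<Rightarrow> bool" where
  "dominated xs ys \<longleftrightarrow> list_all2 (\<ge>) xs (take (length xs) ys)"

context decreasing_vector
begin

lemma sum_list_dominated:
  assumes "dominated xs ys" "set xs \<subseteq> {1..n}" "set ys \<subseteq> {1..n}"
  shows "(\<Sum>i\<leftarrow>xs. a i) \<le> (\<Sum>i\<leftarrow>ys. a i)"
proof -
  have "(\<Sum>i\<leftarrow>xs. a i) \<le> (\<Sum>i\<leftarrow>zs. a i)"
    if "list_all2 (\<ge>) xs zs" "set xs \<subseteq> {1..n}" "set zs \<subseteq> {1..n}" for zs
    using that by (induction rule: list_all2_induct) (auto intro!: add_mono decreasing)
  then have "(\<Sum>i\<leftarrow>xs. a i) \<le> (\<Sum>i\<leftarrow>take (length xs) ys. a i)"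
    using assms set_take_subset[of "length xs" ys] unfolding dominated_def by blast
  also have "\<dots> \<le> (\<Sum>i\<leftarrow>take (length xs) ys. a i) + (\<Sum>i\<leftarrow>drop (length xs) ys. a i)"
  proof -
    have "0 \<le> a i" if "i \<in> set (drop (length xs) ys)" for i
      using that assms(3) pos[of i] set_drop_subset[of "length xs" ys] by auto
    then show ?thesis by (auto intro!: sum_list_nonneg)
  qed
  also have "\<dots> = (\<Sum>i\<leftarrow>ys. a i)"
    by (metis append_take_drop_id map_append sum_list_append)
  finally show ?thesis .
qed

lemma wins_mono:
  "\<lbrakk>wins n a ys; dominated xs ys; set xs \<subseteq> {1..n}; set ys \<subseteq> {1..n}\<rbrakk> \<Longrightarrow> wins n a xs"
  using sum_list_dominated[of xs ys] unfolding wins_def by linarith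

lemma signed_sum_flips:
  assumes "sorted_wrt (<) xs" "set xs \<subseteq> {1..n}"
  shows "signed_sum n a (set xs) = (\<Sum>i=1..n. a i) - 2 * (\<Sum>i\<leftarrow>xs. a i)"
proof -
  have "distinct xs" using assms(1) strict_sorted_iff by blast
  have "signed_sum n a (set xs) = (\<Sum>i=1..n. a i - 2 * (if i \<in> set xs then a i else 0))"
    unfolding signed_sum_def by (intro sum.cong) auto
  also have "\<dots> = (\<Sum>i=1..n. a i) - 2 * (\<Sum>i\<in>{1..n} \<inter> set xs. a i)"
    by (simp add: sum_subtractf sum.inter_restrict sum_distrib_left)
  also have "{1..n} \<inter> set xs = set xs" using assms(2) by auto
  also have "(\<Sum>i\<in>set xs. a i) = (\<Sum>i\<leftarrow>xs. a i)"
    using \<open>distinct xs\<close> by (simp add: sum_list_distinct_conv_sum_set)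
  finally show ?thesis .
qed

text \<open>
  Each list in \<open>F\<close> wins because it is dominated by a list in \<open>W\<close>.
  The factor 2 comes from negating the winning patterns: their complements have signed sums
  below \<open>- N\<close>.
\<close>

lemma sign_count_ge:
  assumes "distinct F"
    and "\<forall>xs\<in>set F. sorted_wrt (<) xs \<and> set xs \<subseteq> {1..n} \<and> (\<exists>ys\<in>set W. dominated xs ys)"
    and "\<forall>ys\<in>set W. set ys \<subseteq> {1..n} \<and> wins n a ys"
  shows "2 * length F \<le> sign_count n a (\<lambda>x. L2_set a {1..n} < \<bar>x\<bar>)"
proof -
  let ?N = "L2_set a {1..n}" and ?S = "signed_sum n a" and ?c = "\<lambda>T. {1..n} - T"
  have win: "?N < ?S T" "T \<subseteq> {1..n}" if "T \<in> set ` set F" for T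
  proof -
    obtain xs where xs: "xs \<in> set F" "T = set xs" using \<open>T \<in> set ` set F\<close> by blast
    then obtain ys where "ys \<in> set W" "dominated xs ys" using assms(2) by blast
    then have "wins n a xs" using assms(2,3) xs wins_mono by blast
    then show "?N < ?S T" "T \<subseteq> {1..n}"
      using assms(2) xs signed_sum_flips[of xs] by (auto simp: wins_def)
  qed
  have N: "0 \<le> ?N" by simp
  have "inj_on set (set F)"
    using assms(2) by (intro inj_onI) (blast intro: strict_sorted_equal)
  then have 1: "card (set ` set F) = length F"
    using assms(1) by (simp add: card_image distinct_card)
  have "inj_on ?c (set ` set F)"
    using win(2) by (intro inj_onI) blast
  then have 2: "card (?c ` set ` set F) = length F"
    by (simp only: card_image 1)
  have "set ` set F \<inter> ?c ` set ` set F = {}"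
  proof (rule ccontr)
    assume "\<not> ?thesis"
    then obtain T U where "T \<in> set ` set F" "U \<in> set ` set F" "T = ?c U" by blast
    then have "?N < ?S U" "?N < - ?S U"
      using win(1) signed_sum_complement[of n a U] by metis+
    then show False using N by linarith
  qed
  then have "card (set ` set F \<union> ?c ` set ` set F) = length F + length F"
    by (subst card_Un_disjoint) (simp_all only: 1 2 finite_imageI finite_set)
  moreover have "set ` set F \<union> ?c ` set ` set F \<subseteq> {T. T \<subseteq> {1..n} \<and> ?N < \<bar>?S T\<bar>}"
  proof (intro Un_least image_subsetI CollectI conjI)
    fix xs assume "xs \<in> set F"
    then have w: "?N < ?S (set xs)" "set xs \<subseteq> {1..n}" using win by auto
    then show "?N < \<bar>?S (set xs)\<bar>" "set xs \<subseteq> {1..n}" by auto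
  next
    fix T assume "T \<in> set ` set F"
    then show "?N < \<bar>?S (?c T)\<bar>" using win(1)[of T] N signed_sum_complement[of n a T] by simp
  qed auto
  moreover have "finite {T. T \<subseteq> {1..n} \<and> ?N < \<bar>?S T\<bar>}" by simp
  ultimately show ?thesis
    unfolding sign_count_def mult_2 by (metis (no_types, lifting) card_mono)
qed

end

section \<open>Bounds on the norm from staircase decompositions\<close>

text \<open>
  The triangle inequality for \<open>a = (\<Sum>(c, v, r)\<leftarrow>L. c * v)\<close>,
  where \<open>r\<close> is an upper bound on the norm of \<open>v\<close>. Carrying
  \<open>r\<close> instead of the norm keeps the result rational.
\<close>

lemma L2_set_le_conic:
  fixes a :: "nat \<Rightarrow> real"
  assumes "\<forall>i\<in>A. a i = (\<Sum>(c, v, r)\<leftarrow>L. c * v i)"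
    and "\<forall>(c, v, r)\<in>set L. 0 \<le> c \<and> 0 \<le> r \<and> (\<Sum>i\<in>A. (v i)\<^sup>2) \<le> r\<^sup>2"
  shows "L2_set a A \<le> (\<Sum>(c, v, r)\<leftarrow>L. c * r)"
  using assms
proof (induction L arbitrary: a)
  case Nil
  then have "L2_set a A = L2_set (\<lambda>_. 0) A"
    by (intro L2_set_cong) auto
  then show ?case by (simp add: L2_set_def)
next
  case (Cons x L)
  obtain c v r where x: "x = (c, v, r)" by (cases x)
  let ?b = "\<lambda>i. \<Sum>(c, v, r)\<leftarrow>L. c * v i"
  have r: "0 \<le> c" "0 \<le> r" "(\<Sum>i\<in>A. (v i)\<^sup>2) \<le> r\<^sup>2"
    using Cons.prems(2) x by auto
  have "L2_set a A = L2_set (\<lambda>i. c * v i + ?b i) A"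
    using Cons.prems(1) x by (intro L2_set_cong) auto
  also have "\<dots> \<le> L2_set (\<lambda>i. c * v i) A + L2_set ?b A"
    by (rule L2_set_triangle_ineq)
  also have "L2_set (\<lambda>i. c * v i) A = c * L2_set v A"
    using r(1) by (simp add: L2_set_right_distrib)
  also have "L2_set v A \<le> r"
    using r unfolding L2_set_def by (simp add: real_le_lsqrt sum_nonneg)
  also have "L2_set ?b A \<le> (\<Sum>(c, v, r)\<leftarrow>L. c * r)"
    using Cons.prems(2) by (intro Cons.IH) auto
  finally show ?case using r x by (simp add: mult_left_mono)
qed

text \<open>
  A decreasing vector is a nonnegative combination of staircases in many ways. Merging
  several one-step staircases into one with several steps improves the bound on the norm.
\<close>

definition staircase :: "nat list \<Rightarrow> nat \<Rightarrow> real" where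
  "staircase J i = (\<Sum>j\<leftarrow>J. of_bool (i \<le> j))"

lemma interval_expand:
  "{1..5::nat} = {1, 2, 3, 4, 5}" "{1..6::nat} = {1, 2, 3, 4, 5, 6}"
  "{1..7::nat} = {1, 2, 3, 4, 5, 6, 7}"
  by auto

lemma norm_le_staircases:
  fixes a :: "nat \<Rightarrow> real"
  assumes "\<forall>i\<in>{1..n}. a i = (\<Sum>(c, J, r)\<leftarrow>L. c * staircase J i)"
    and "\<forall>(c, J, r)\<in>set L. 0 \<le> c \<and> 0 \<le> r \<and> (\<Sum>i=1..n. (staircase J i)\<^sup>2) \<le> r\<^sup>2"
  shows "L2_set a {1..n} \<le> (\<Sum>(c, J, r)\<leftarrow>L. c * r)"
  using L2_set_le_conic[of "{1..n}" a "map (\<lambda>(c, J, r). (c, staircase J, r)) L"] assms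
  by (simp add: case_prod_unfold comp_def)

lemma gaps5:
  assumes "decreasing_vector 5 a"
  shows "a 2 \<le> a 1" "a 3 \<le> a 2" "a 4 \<le> a 3" "a 5 \<le> a 4" "0 < a 5"
  using assms by (auto simp: decreasing_vector_def)

lemma gaps6:
  assumes "decreasing_vector 6 a"
  shows "a 2 \<le> a 1" "a 3 \<le> a 2" "a 4 \<le> a 3" "a 5 \<le> a 4" "a 6 \<le> a 5"
    "0 < a 6"
  using assms by (auto simp: decreasing_vector_def)

lemma gaps7:
  assumes "decreasing_vector 7 a"
  shows "a 2 \<le> a 1" "a 3 \<le> a 2" "a 4 \<le> a 3" "a 5 \<le> a 4" "a 6 \<le> a 5"
    "a 7 \<le> a 6" "0 < a 7"
  using assms by (auto simp: decreasing_vector_def)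

text \<open>
  The bounds on the norm are stated as linear inequalities in the coordinates. The first
  three use only the one-step staircases \<open>[j]\<close>, of norm \<open>sqrt j\<close>,
  with the upper bounds 17/12, 7/4, 56/25, 49/20, 53/20 on the square roots of 2, 3, 5, 6,
  7. The coefficient of a coordinate is the difference of two consecutive bounds on square
  roots, because the gaps are differences of coordinates.
\<close>

lemma norm_bound5:
  assumes "decreasing_vector 5 a"
  shows "L2_set a {1..5} \<le> a 1 + 5/12 * a 2 + 1/3 * a 3 + 1/4 * a 4 + 6/25 * a 5"
proof -
  let ?L = "[(a 1 - a 2, [1], 1),
    (a 2 - a 3, [2], 17/12),
    (a 3 - a 4, [3], 7/4),
    (a 4 - a 5, [4], 2),
    (a 5, [5], 56/25)]"
  have 1: "\<forall>i\<in>{1..5}. a i = (\<Sum>(c, J, r)\<leftarrow>?L. c * staircase J i)"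
    unfolding interval_expand by (simp add: staircase_def)
  have 2: "\<forall>(c, J, r)\<in>set ?L. 0 \<le> c \<and> 0 \<le> r \<and>
      (\<Sum>i=1..5. (staircase J i)\<^sup>2) \<le> r\<^sup>2"
    using gaps5[OF assms(1)]
    unfolding interval_expand by (simp add: staircase_def power2_eq_square)
  show ?thesis
    using norm_le_staircases[OF 1 2] by (simp add: field_simps del: One_nat_def)
qed

lemma norm_bound6:
  assumes "decreasing_vector 6 a"
  shows "L2_set a {1..6}
    \<le> a 1 + 5/12 * a 2 + 1/3 * a 3 + 1/4 * a 4 + 6/25 * a 5 + 21/100 * a 6"
proof -
  let ?L = "[(a 1 - a 2, [1], 1),
    (a 2 - a 3, [2], 17/12),
    (a 3 - a 4, [3], 7/4),
    (a 4 - a 5, [4], 2),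
    (a 5 - a 6, [5], 56/25),
    (a 6, [6], 49/20)]"
  have 1: "\<forall>i\<in>{1..6}. a i = (\<Sum>(c, J, r)\<leftarrow>?L. c * staircase J i)"
    unfolding interval_expand by (simp add: staircase_def)
  have 2: "\<forall>(c, J, r)\<in>set ?L. 0 \<le> c \<and> 0 \<le> r \<and>
      (\<Sum>i=1..6. (staircase J i)\<^sup>2) \<le> r\<^sup>2"
    using gaps6[OF assms(1)]
    unfolding interval_expand by (simp add: staircase_def power2_eq_square)
  show ?thesis
    using norm_le_staircases[OF 1 2] by (simp add: field_simps del: One_nat_def)
qed

lemma norm_bound7:
  assumes "decreasing_vector 7 a"
  shows "L2_set a {1..7}
    \<le> a 1 + 5/12 * a 2 + 1/3 * a 3 + 1/4 * a 4 + 6/25 * a 5 + 21/100 * a 6 + 1/5 * a 7"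
proof -
  let ?L = "[(a 1 - a 2, [1], 1),
    (a 2 - a 3, [2], 17/12),
    (a 3 - a 4, [3], 7/4),
    (a 4 - a 5, [4], 2),
    (a 5 - a 6, [5], 56/25),
    (a 6 - a 7, [6], 49/20),
    (a 7, [7], 53/20)]"
  have 1: "\<forall>i\<in>{1..7}. a i = (\<Sum>(c, J, r)\<leftarrow>?L. c * staircase J i)"
    unfolding interval_expand by (simp add: staircase_def)
  have 2: "\<forall>(c, J, r)\<in>set ?L. 0 \<le> c \<and> 0 \<le> r \<and>
      (\<Sum>i=1..7. (staircase J i)\<^sup>2) \<le> r\<^sup>2"
    using gaps7[OF assms(1)]
    unfolding interval_expand by (simp add: staircase_def power2_eq_square)
  show ?thesis
    using norm_le_staircases[OF 1 2] by (simp add: field_simps del: One_nat_def)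
qed

text \<open>
  Bounds sharpened by the staircase \<open>[1, 6]\<close> of norm 3, which replaces as many
  of the staircases \<open>[1]\<close> and \<open>[6]\<close> as the smaller of the two gaps
  allows.
\<close>

lemma norm_bound7_gap6_le_gap1:
  assumes "decreasing_vector 7 a"
    and "a 6 - a 7 \<le> a 1 - a 2"
  shows "L2_set a {1..7}
    \<le> a 1 + 5/12 * a 2 + 1/3 * a 3 + 1/4 * a 4 + 6/25 * a 5 - 6/25 * a 6 + 13/20 * a 7"
proof -
  let ?L = "[(a 1 - a 2 - (a 6 - a 7), [1], 1),
    (a 2 - a 3, [2], 17/12),
    (a 3 - a 4, [3], 7/4),
    (a 4 - a 5, [4], 2),
    (a 5 - a 6, [5], 56/25),
    (a 6 - a 7, [1, 6], 3),
    (a 7, [7], 53/20)]"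
  have 1: "\<forall>i\<in>{1..7}. a i = (\<Sum>(c, J, r)\<leftarrow>?L. c * staircase J i)"
    unfolding interval_expand by (simp add: staircase_def)
  have 2: "\<forall>(c, J, r)\<in>set ?L. 0 \<le> c \<and> 0 \<le> r \<and>
      (\<Sum>i=1..7. (staircase J i)\<^sup>2) \<le> r\<^sup>2"
    using gaps7[OF assms(1)] assms(2-)
    unfolding interval_expand by (simp add: staircase_def power2_eq_square)
  show ?thesis
    using norm_le_staircases[OF 1 2] by (simp add: field_simps del: One_nat_def)
qed

lemma norm_bound7_gap1_le_gap6:
  assumes "decreasing_vector 7 a"
    and "a 1 - a 2 \<le> a 6 - a 7"
  shows "L2_set a {1..7}
    \<le> 11/20 * a 1 + 13/15 * a 2 + 1/3 * a 3 + 1/4 * a 4 + 6/25 * a 5 + 21/100 * a 6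
      + 1/5 * a 7"
proof -
  let ?L = "[(a 1 - a 2, [1, 6], 3),
    (a 2 - a 3, [2], 17/12),
    (a 3 - a 4, [3], 7/4),
    (a 4 - a 5, [4], 2),
    (a 5 - a 6, [5], 56/25),
    (a 6 - a 7 - (a 1 - a 2), [6], 49/20),
    (a 7, [7], 53/20)]"
  have 1: "\<forall>i\<in>{1..7}. a i = (\<Sum>(c, J, r)\<leftarrow>?L. c * staircase J i)"
    unfolding interval_expand by (simp add: staircase_def)
  have 2: "\<forall>(c, J, r)\<in>set ?L. 0 \<le> c \<and> 0 \<le> r \<and>
      (\<Sum>i=1..7. (staircase J i)\<^sup>2) \<le> r\<^sup>2"
    using gaps7[OF assms(1)] assms(2-)
    unfolding interval_expand by (simp add: staircase_def power2_eq_square)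
  show ?thesis
    using norm_le_staircases[OF 1 2] by (simp add: field_simps del: One_nat_def)
qed

text \<open>
  Bounds sharpened by the staircases \<open>[1, 3, 7]\<close>, of norm \<open>sqrt 21 \<le>
  23/5\<close>, and \<open>[3, 7]\<close>, of norm 4. As many as possible of the staircases
  \<open>[1]\<close>, \<open>[3]\<close>, \<open>[7]\<close> are merged into \<open>[1, 3,
  7]\<close> and then, if \<open>[1]\<close> is used up first, of the remaining ones into
  \<open>[3, 7]\<close>. The four cases are the possible orders of the three gaps, as far as
  they matter.
\<close>

lemma norm_bound7_gap7_least:
  assumes "decreasing_vector 7 a"
    and "a 7 \<le> a 3 - a 4"
    and "a 7 \<le> a 1 - a 2"
  shows "L2_set a {1..7}
    \<le> a 1 + 5/12 * a 2 + 1/3 * a 3 + 1/4 * a 4 + 6/25 * a 5 + 21/100 * a 6 - 3/5 * a 7"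
proof -
  let ?L = "[(a 2 - a 3, [2], 17/12),
    (a 4 - a 5, [4], 2),
    (a 5 - a 6, [5], 56/25),
    (a 6 - a 7, [6], 49/20),
    (a 7, [1, 3, 7], 23/5),
    (a 1 - a 2 - a 7, [1], 1),
    (a 3 - a 4 - a 7, [3], 7/4)]"
  have 1: "\<forall>i\<in>{1..7}. a i = (\<Sum>(c, J, r)\<leftarrow>?L. c * staircase J i)"
    unfolding interval_expand by (simp add: staircase_def)
  have 2: "\<forall>(c, J, r)\<in>set ?L. 0 \<le> c \<and> 0 \<le> r \<and>
      (\<Sum>i=1..7. (staircase J i)\<^sup>2) \<le> r\<^sup>2"
    using gaps7[OF assms(1)] assms(2-)
    unfolding interval_expand by (simp add: staircase_def power2_eq_square)
  show ?thesis
    using norm_le_staircases[OF 1 2] by (simp add: field_simps del: One_nat_def)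
qed

lemma norm_bound7_gap3_least:
  assumes "decreasing_vector 7 a"
    and "a 3 - a 4 \<le> a 7"
    and "a 3 - a 4 \<le> a 1 - a 2"
  shows "L2_set a {1..7}
    \<le> a 1 + 5/12 * a 2 - 7/15 * a 3 + 21/20 * a 4 + 6/25 * a 5 + 21/100 * a 6 + 1/5 * a 7"
proof -
  let ?L = "[(a 2 - a 3, [2], 17/12),
    (a 4 - a 5, [4], 2),
    (a 5 - a 6, [5], 56/25),
    (a 6 - a 7, [6], 49/20),
    (a 3 - a 4, [1, 3, 7], 23/5),
    (a 1 - a 2 - (a 3 - a 4), [1], 1),
    (a 7 - (a 3 - a 4), [7], 53/20)]"
  have 1: "\<forall>i\<in>{1..7}. a i = (\<Sum>(c, J, r)\<leftarrow>?L. c * staircase J i)"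
    unfolding interval_expand by (simp add: staircase_def)
  have 2: "\<forall>(c, J, r)\<in>set ?L. 0 \<le> c \<and> 0 \<le> r \<and>
      (\<Sum>i=1..7. (staircase J i)\<^sup>2) \<le> r\<^sup>2"
    using gaps7[OF assms(1)] assms(2-)
    unfolding interval_expand by (simp add: staircase_def power2_eq_square)
  show ?thesis
    using norm_le_staircases[OF 1 2] by (simp add: field_simps del: One_nat_def)
qed

lemma norm_bound7_gap1_le_gap7_le_gap3:
  assumes "decreasing_vector 7 a"
    and "a 7 \<le> a 3 - a 4"
    and "a 1 - a 2 \<le> a 7"
  shows "L2_set a {1..7}
    \<le> 3/5 * a 1 + 49/60 * a 2 + 1/3 * a 3 + 1/4 * a 4 + 6/25 * a 5
      + 21/100 * a 6 - 1/5 * a 7"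
proof -
  let ?L = "[(a 2 - a 3, [2], 17/12),
    (a 4 - a 5, [4], 2),
    (a 5 - a 6, [5], 56/25),
    (a 6 - a 7, [6], 49/20),
    (a 1 - a 2, [1, 3, 7], 23/5),
    (a 7 - (a 1 - a 2), [3, 7], 4),
    (a 3 - a 4 - a 7, [3], 7/4)]"
  have 1: "\<forall>i\<in>{1..7}. a i = (\<Sum>(c, J, r)\<leftarrow>?L. c * staircase J i)"
    unfolding interval_expand by (simp add: staircase_def)
  have 2: "\<forall>(c, J, r)\<in>set ?L. 0 \<le> c \<and> 0 \<le> r \<and>
      (\<Sum>i=1..7. (staircase J i)\<^sup>2) \<le> r\<^sup>2"
    using gaps7[OF assms(1)] assms(2-)
    unfolding interval_expand by (simp add: staircase_def power2_eq_square)
  show ?thesis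
    using norm_le_staircases[OF 1 2] by (simp add: field_simps del: One_nat_def)
qed

lemma norm_bound7_gap1_le_gap3_le_gap7:
  assumes "decreasing_vector 7 a"
    and "a 3 - a 4 \<le> a 7"
    and "a 1 - a 2 \<le> a 3 - a 4"
  shows "L2_set a {1..7}
    \<le> 3/5 * a 1 + 49/60 * a 2 - 1/15 * a 3 + 13/20 * a 4 + 6/25 * a 5
      + 21/100 * a 6 + 1/5 * a 7"
proof -
  let ?L = "[(a 2 - a 3, [2], 17/12),
    (a 4 - a 5, [4], 2),
    (a 5 - a 6, [5], 56/25),
    (a 6 - a 7, [6], 49/20),
    (a 1 - a 2, [1, 3, 7], 23/5),
    (a 3 - a 4 - (a 1 - a 2), [3, 7], 4),
    (a 7 - (a 3 - a 4), [7], 53/20)]"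
  have 1: "\<forall>i\<in>{1..7}. a i = (\<Sum>(c, J, r)\<leftarrow>?L. c * staircase J i)"
    unfolding interval_expand by (simp add: staircase_def)
  have 2: "\<forall>(c, J, r)\<in>set ?L. 0 \<le> c \<and> 0 \<le> r \<and>
      (\<Sum>i=1..7. (staircase J i)\<^sup>2) \<le> r\<^sup>2"
    using gaps7[OF assms(1)] assms(2-)
    unfolding interval_expand by (simp add: staircase_def power2_eq_square)
  show ?thesis
    using norm_le_staircases[OF 1 2] by (simp add: field_simps del: One_nat_def)
qed

section \<open>Lists of which at least one wins\<close>

text \<open>
  Each proof refutes the failure of all lists by linear arithmetic. The weights given in
  front of it belong to the lists in their order. For every staircase \<open>J\<close> in
  the decomposition behind the bound on the norm, the partial sums of the signs up to the
  indices in \<open>J\<close>, added up and averaged with these weights, are at least the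
  bound used for the norm of the staircase.
\<close>

lemma wins5: "wins 5 a xs \<longleftrightarrow>
    L2_set a {1..5} < a 1 + a 2 + a 3 + a 4 + a 5 - 2 * (\<Sum>i\<leftarrow>xs. a i)"
proof -
  have "(\<Sum>i=1..5. a i) = a 1 + a 2 + a 3 + a 4 + a 5"
    unfolding interval_expand by simp
  then show ?thesis by (simp only: wins_def)
qed

lemma wins6: "wins 6 a xs \<longleftrightarrow>
    L2_set a {1..6} < a 1 + a 2 + a 3 + a 4 + a 5 + a 6 - 2 * (\<Sum>i\<leftarrow>xs. a i)"
proof -
  have "(\<Sum>i=1..6. a i) = a 1 + a 2 + a 3 + a 4 + a 5 + a 6"
    unfolding interval_expand by simp
  then show ?thesis by (simp only: wins_def)
qed

lemma wins7: "wins 7 a xs \<longleftrightarrow>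
    L2_set a {1..7} < a 1 + a 2 + a 3 + a 4 + a 5 + a 6 + a 7 - 2 * (\<Sum>i\<leftarrow>xs. a i)"
proof -
  have "(\<Sum>i=1..7. a i) = a 1 + a 2 + a 3 + a 4 + a 5 + a 6 + a 7"
    unfolding interval_expand by simp
  then show ?thesis by (simp only: wins_def)
qed

lemma wins5_3_or_45:
  assumes "decreasing_vector 5 a"
  shows "wins 5 a [3] \<or> wins 5 a [4, 5]"
  (* weights 5/8, 3/8 *)
  using norm_bound5[OF assms] gaps5[OF assms] unfolding wins5
  by (simp del: One_nat_def; argo)

lemma wins6_3_or_46:
  assumes "decreasing_vector 6 a"
  shows "wins 6 a [3] \<or> wins 6 a [4, 6]"
  (* weights 1/4, 3/4 *)
  using norm_bound6[OF assms] gaps6[OF assms] unfolding wins6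
  by (simp del: One_nat_def; argo)

lemma wins6_2_or_56:
  assumes "decreasing_vector 6 a"
  shows "wins 6 a [2] \<or> wins 6 a [5, 6]"
  (* weights 7/24, 17/24 *)
  using norm_bound6[OF assms] gaps6[OF assms] unfolding wins6
  by (simp del: One_nat_def; argo)

lemma wins7_27_or_36_or_45:
  assumes "decreasing_vector 7 a"
  shows "wins 7 a [2, 7] \<or> wins 7 a [3, 6] \<or> wins 7 a [4, 5]"
  (* weights 7/24, 1/3, 3/8 *)
  using norm_bound7[OF assms] gaps7[OF assms] unfolding wins7
  by (simp del: One_nat_def; argo)

lemma wins7_2_or_45_or_567:
  assumes "decreasing_vector 7 a"
  shows "wins 7 a [2] \<or> wins 7 a [4, 5] \<or> wins 7 a [5, 6, 7]"
  (* weights 7/24, 1/4, 11/24 *)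
  using norm_bound7[OF assms] gaps7[OF assms] unfolding wins7
  by (simp del: One_nat_def; argo)

lemma wins7_2_or_36_or_457:
  assumes "decreasing_vector 7 a"
  shows "wins 7 a [2] \<or> wins 7 a [3, 6] \<or> wins 7 a [4, 5, 7]"
  (* weights 7/24, 1/3, 3/8 *)
  using norm_bound7[OF assms] gaps7[OF assms] unfolding wins7
  by (simp del: One_nat_def; argo)

lemma wins7_17_or_56:
  assumes "decreasing_vector 7 a"
  shows "wins 7 a [1, 7] \<or> wins 7 a [5, 6]"
proof (cases "a 6 - a 7 \<le> a 1 - a 2")
  case c1: True
  show ?thesis
    (* weights 0, 1 *)
    using norm_bound7_gap6_le_gap1[OF assms c1] c1 gaps7[OF assms] unfolding wins7
    by (simp del: One_nat_def; argo)
next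
  case False
  then have c1: "a 1 - a 2 \<le> a 6 - a 7" by simp
  show ?thesis
    (* weights 7/24, 17/24 *)
    using norm_bound7_gap1_le_gap6[OF assms c1] c1 gaps7[OF assms] unfolding wins7
    by (simp del: One_nat_def; argo)
qed

lemma wins7_1_or_46_or_567:
  assumes "decreasing_vector 7 a"
  shows "wins 7 a [1] \<or> wins 7 a [4, 6] \<or> wins 7 a [5, 6, 7]"
proof (cases "a 6 - a 7 \<le> a 1 - a 2")
  case c1: True
  show ?thesis
    (* weights 0, 1, 0 *)
    using norm_bound7_gap6_le_gap1[OF assms c1] c1 gaps7[OF assms] unfolding wins7
    by (simp del: One_nat_def; argo)
next
  case False
  then have c1: "a 1 - a 2 \<le> a 6 - a 7" by simp
  show ?thesis
    (* weights 7/24, 17/24, 0 *)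
    using norm_bound7_gap1_le_gap6[OF assms c1] c1 gaps7[OF assms] unfolding wins7
    by (simp del: One_nat_def; argo)
qed

text \<open>
  The most delicate alternative: at the extremal vector \<open>(2, 2, 2, 1, 1, 1, 1)\<close>
  the signed sums of the last two lists equal the norm. Only the first list wins there, so
  it must get positive weight when the first gap is small, and weight 0 when the first gap
  is large.
\<close>

lemma wins7_1_or_37_or_567:
  assumes "decreasing_vector 7 a"
  shows "wins 7 a [1] \<or> wins 7 a [3, 7] \<or> wins 7 a [5, 6, 7]"
proof (cases "a 3 - a 4 \<le> a 7")
  case c1: True
  show ?thesis
  proof (cases "a 3 - a 4 \<le> a 1 - a 2")
    case c2: True
    show ?thesis
      (* weights 0, 83/100, 17/100 *)
      using norm_bound7_gap3_least[OF assms c1 c2] c1 c2 gaps7[OF assms] unfolding wins7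
      by (simp del: One_nat_def; argo)
  next
    case False
    then have c2: "a 1 - a 2 \<le> a 3 - a 4" by simp
    show ?thesis
      (* weights 7/24, 17/24, 0 *)
      using norm_bound7_gap1_le_gap3_le_gap7[OF assms c1 c2] c1 c2 gaps7[OF assms]
      unfolding wins7
      by (simp del: One_nat_def; argo)
  qed
next
  case False
  then have c1: "a 7 \<le> a 3 - a 4" by simp
  show ?thesis
  proof (cases "a 7 \<le> a 1 - a 2")
    case c2: True
    show ?thesis
      (* weights 0, 5/8, 3/8 *)
      using norm_bound7_gap7_least[OF assms c1 c2] c1 c2 gaps7[OF assms] unfolding wins7
      by (simp del: One_nat_def; argo)
  next
    case False
    then have c2: "a 1 - a 2 \<le> a 7" by simp
    show ?thesis
      (* weights 7/24, 1/3, 3/8 *)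
      using norm_bound7_gap1_le_gap7_le_gap3[OF assms c1 c2] c1 c2 gaps7[OF assms]
      unfolding wins7
      by (simp del: One_nat_def; argo)
  qed
qed

section \<open>Lower bounds on the number of sign patterns\<close>

text \<open>
  The sum of the coordinates exceeds the norm, so flipping nothing wins.
\<close>

lemma sign_count_ge_2:
  assumes "decreasing_vector n a" "n \<ge> 2"
  shows "2 \<le> sign_count n a (\<lambda>x. L2_set a {1..n} < \<bar>x\<bar>)"
proof -
  interpret decreasing_vector n a by fact
  have split: "{1..n} = insert 1 {2..n}" using assms(2) by auto
  define r where "r = L2_set a {2..n}"
  have "L2_set a {1..n} = sqrt ((a 1)\<^sup>2 + r\<^sup>2)"
    unfolding split r_def by simp
  also have "\<dots> < a 1 + r"
  proof (rule real_less_lsqrt)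
    have "0 < a 1" using pos assms(2) by simp
    moreover have "0 < r"
      using assms(2) pos[of 2] member_le_L2_set[of "{2..n}" 2 a] unfolding r_def by simp
    ultimately show "0 \<le> a 1 + r" "(a 1)\<^sup>2 + r\<^sup>2 < (a 1 + r)\<^sup>2"
      by (simp_all add: power2_sum)
  qed
  also have "r \<le> (\<Sum>i=2..n. a i)"
    unfolding r_def by (rule L2_set_le_sum) (auto intro!: less_imp_le pos)
  also have "a 1 + (\<Sum>i=2..n. a i) = (\<Sum>i=1..n. a i)"
    unfolding split by simp
  finally have "L2_set a {1..n} < (\<Sum>i=1..n. a i)" by simp
  then show ?thesis
    using sign_count_ge[of "[[]]" "[[]]"] by (simp add: dominated_def wins_def)
qed

lemma sign_count_ge_5:
  assumes "decreasing_vector 5 a"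
  shows "8 \<le> sign_count 5 a (\<lambda>x. L2_set a {1..5} < \<bar>x\<bar>)"
proof -
  interpret decreasing_vector 5 a by fact
  from wins5_3_or_45[OF assms] show ?thesis
  proof
    assume "wins 5 a [3]"
    then show ?thesis
      using sign_count_ge[of "[[], [5], [4], [3]]" "[[3]]"] by (simp add: dominated_def)
  next
    assume "wins 5 a [4, 5]"
    then show ?thesis
      using sign_count_ge[of "[[], [5], [4], [4, 5]]" "[[4, 5]]"] by (simp add: dominated_def)
  qed
qed

lemma sign_count_ge_6:
  assumes "decreasing_vector 6 a"
  shows "12 \<le> sign_count 6 a (\<lambda>x. L2_set a {1..6} < \<bar>x\<bar>)"
proof -
  interpret decreasing_vector 6 a by fact
  from wins6_3_or_46[OF assms] show ?thesis
  proof
    assume 3: "wins 6 a [3]"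
    from wins6_2_or_56[OF assms] show ?thesis
    proof
      assume "wins 6 a [2]"
      with 3 show ?thesis
        using sign_count_ge[of "[[], [6], [5], [4], [3], [2]]" "[[2], [3]]"]
        by (simp add: dominated_def)
    next
      assume "wins 6 a [5, 6]"
      with 3 show ?thesis
        using sign_count_ge[of "[[], [6], [5], [4], [3], [5, 6]]" "[[3], [5, 6]]"]
        by (simp add: dominated_def)
    qed
  next
    assume "wins 6 a [4, 6]"
    then show ?thesis
      using sign_count_ge[of "[[], [6], [5], [4], [5, 6], [4, 6]]" "[[4, 6]]"]
      by (simp add: dominated_def)
  qed
qed

text \<open>
  In each case \<open>?F\<close> lists everything that is dominated by the list under
  consideration: 13, 12 and 11 lists for 36, 27 and 45. The alternatives provide the missing
  ones.
\<close>

lemma sign_count_ge_7: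
  assumes "decreasing_vector 7 a"
  shows "28 \<le> sign_count 7 a (\<lambda>x. L2_set a {1..7} < \<bar>x\<bar>)" (is "?goal")
proof -
  interpret decreasing_vector 7 a by fact
  have via36: ?goal if 36: "wins 7 a [3, 6]"
  proof -
    let ?F = "[[], [7], [6], [5], [4], [3], [6, 7], [5, 7], [5, 6], [4, 7], [4, 6], [3, 7], [3, 6]]"
    from wins7_2_or_45_or_567[OF assms] consider
      "wins 7 a [2]" | "wins 7 a [4, 5]" | "wins 7 a [5, 6, 7]" by blast
    then show ?goal
    proof cases
      case 1
      with 36 show ?goal
        using sign_count_ge[of "[2] # ?F" "[[2], [3, 6]]"] by (simp add: dominated_def)
    next
      case 2
      with 36 show ?goal
        using sign_count_ge[of "[4, 5] # ?F" "[[4, 5], [3, 6]]"] by (simp add: dominated_def)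
    next
      case 3
      with 36 show ?goal
        using sign_count_ge[of "[5, 6, 7] # ?F" "[[5, 6, 7], [3, 6]]"]
        by (simp add: dominated_def)
    qed
  qed
  have via27: ?goal if 27: "wins 7 a [2, 7]"
  proof -
    let ?F = "[[], [7], [6], [5], [4], [3], [2], [6, 7], [5, 7], [4, 7], [3, 7], [2, 7]]"
    from wins7_17_or_56[OF assms] show ?goal
    proof
      assume "wins 7 a [1, 7]"
      with 27 show ?goal
        using sign_count_ge[of "[1] # [1, 7] # ?F" "[[1, 7], [2, 7]]"]
        by (simp add: dominated_def)
    next
      assume 56: "wins 7 a [5, 6]"
      from wins7_1_or_46_or_567[OF assms] consider
        "wins 7 a [1]" | "wins 7 a [4, 6]" | "wins 7 a [5, 6, 7]" by blast
      then show ?goal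
      proof cases
        case 1
        with 27 56 show ?goal
          using sign_count_ge[of "[1] # [5, 6] # ?F" "[[1], [5, 6], [2, 7]]"]
          by (simp add: dominated_def)
      next
        case 2
        with 27 56 show ?goal
          using sign_count_ge[of "[4, 6] # [5, 6] # ?F" "[[4, 6], [5, 6], [2, 7]]"]
          by (simp add: dominated_def)
      next
        case 3
        with 27 56 show ?goal
          using sign_count_ge[of "[5, 6, 7] # [5, 6] # ?F" "[[5, 6, 7], [5, 6], [2, 7]]"]
          by (simp add: dominated_def)
      qed
    qed
  qed
  have via45: ?goal if 45: "wins 7 a [4, 5]"
  proof -
    let ?F = "[[], [7], [6], [5], [4], [6, 7], [5, 7], [5, 6], [4, 7], [4, 6], [4, 5]]"
    from wins7_2_or_36_or_457[OF assms] consider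
      "wins 7 a [2]" | "wins 7 a [3, 6]" | "wins 7 a [4, 5, 7]" by blast
    then show ?goal
    proof cases
      case 1
      from wins7_1_or_37_or_567[OF assms] consider
        "wins 7 a [1]" | "wins 7 a [3, 7]" | "wins 7 a [5, 6, 7]" by blast
      then show ?goal
      proof cases
        case 1
        with 45 \<open>wins 7 a [2]\<close> show ?goal
          using sign_count_ge[of "[1] # [2] # [3] # ?F" "[[1], [2], [4, 5]]"]
          by (simp add: dominated_def)
      next
        case 2
        with 45 \<open>wins 7 a [2]\<close> show ?goal
          using sign_count_ge[of "[3, 7] # [2] # [3] # ?F" "[[3, 7], [2], [4, 5]]"]
          by (simp add: dominated_def)
      next
        case 3
        with 45 \<open>wins 7 a [2]\<close> show ?goal
          using sign_count_ge[of "[5, 6, 7] # [2] # [3] # ?F" "[[5, 6, 7], [2], [4, 5]]"]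
          by (simp add: dominated_def)
      qed
    next
      case 2
      then show ?goal by (rule via36)
    next
      case 3
      with 45 show ?goal
        using sign_count_ge[of "[5, 6, 7] # [4, 6, 7] # [4, 5, 7] # ?F" "[[4, 5, 7], [4, 5]]"]
        by (simp add: dominated_def)
    qed
  qed
  from wins7_27_or_36_or_45[OF assms] via27 via36 via45 show ?goal by blast
qed

section \<open>The values of the infima\<close>

theorem theorem3p3:
  fixes M :: "'w measure" and n :: nat and eps :: "nat \<Rightarrow> 'w \<Rightarrow> real"
  assumes "rademacher_vars M n eps"
  shows "(n = 1 \<longrightarrow> G' M n eps = 0) \<and>
         (n = 2 \<longrightarrow> G' M n eps = 1/2) \<and>
         (n = 3 \<longrightarrow> G' M n eps = 1/4) \<and>
         (n = 4 \<longrightarrow> G' M n eps = 1/8) \<and>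
         (n = 5 \<longrightarrow> G' M n eps = 1/4) \<and>
         (n = 6 \<longrightarrow> G' M n eps = 3/16) \<and>
         (n = 7 \<longrightarrow> G' M n eps = 7/32)"
proof (intro conjI impI)
  let ?ones = "\<lambda>_ :: nat. 1 :: real"
  assume n: "n = 1"
  have "sign_count 1 ?ones (\<lambda>x. (\<Sum>i=1..1. (?ones i)\<^sup>2) < x\<^sup>2) = 0"
    by (simp add: sign_count_eval)
  then show "G' M n eps = 0"
    using G'_eqI[OF assms, of 0 ?ones] n by simp
next
  let ?b = "\<lambda>_ :: nat. 1 :: real"
  assume n: "n = 2"
  have "sign_count 2 ?b (\<lambda>x. (\<Sum>i=1..2. (?b i)\<^sup>2) < x\<^sup>2) = 2"
    by (simp add: sign_count_eval)
  then show "G' M n eps = 1/2"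
    using G'_eqI[OF assms, of 2 ?b] sign_count_ge_2 n by simp
next
  let ?b = "\<lambda>_ :: nat. 1 :: real"
  assume n: "n = 3"
  have "sign_count 3 ?b (\<lambda>x. (\<Sum>i=1..3. (?b i)\<^sup>2) < x\<^sup>2) = 2"
    by (simp add: sign_count_eval)
  then show "G' M n eps = 1/4"
    using G'_eqI[OF assms, of 2 ?b] sign_count_ge_2 n by simp
next
  let ?b = "\<lambda>_ :: nat. 1 :: real"
  assume n: "n = 4"
  have "sign_count 4 ?b (\<lambda>x. (\<Sum>i=1..4. (?b i)\<^sup>2) < x\<^sup>2) = 2"
    by (simp add: sign_count_eval)
  then show "G' M n eps = 1/8"
    using G'_eqI[OF assms, of 2 ?b] sign_count_ge_2 n by simp
next
  let ?b = "\<lambda>i :: nat. if i \<le> 2 then 2 else 1 :: real"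
  assume n: "n = 5"
  have "sign_count 5 ?b (\<lambda>x. (\<Sum>i=1..5. (?b i)\<^sup>2) < x\<^sup>2) = 8"
    by (simp add: sign_count_eval)
  then show "G' M n eps = 1/4"
    using G'_eqI[OF assms, of 8 ?b] sign_count_ge_5 n by simp
next
  let ?b = "\<lambda>i :: nat. if i \<le> 1 then 2 else 1 :: real"
  assume n: "n = 6"
  have "sign_count 6 ?b (\<lambda>x. (\<Sum>i=1..6. (?b i)\<^sup>2) < x\<^sup>2) = 12"
    by (simp add: sign_count_eval)
  then show "G' M n eps = 3/16"
    using G'_eqI[OF assms, of 12 ?b] sign_count_ge_6 n by simp
next
  let ?b = "\<lambda>i :: nat. if i \<le> 3 then 2 else 1 :: real"
  assume n: "n = 7"
  have "sign_count 7 ?b (\<lambda>x. (\<Sum>i=1..7. (?b i)\<^sup>2) < x\<^sup>2) = 28"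
    by (simp add: sign_count_eval)
  then show "G' M n eps = 7/32"
    using G'_eqI[OF assms, of 28 ?b] sign_count_ge_7 n by simp
qed

end
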